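(* Let $(N,A,c)$ be a public bads instance (with linear costs) and let $x\in\Delta(A)$. The following are equivalent. (1) $x$ is proportionally fair. (2) $x$ is a Lindahl allocation. (3) For $S:=\{i\in N: c_i(x)>0\}$, the vector $c_S(x)=(c_i(x))_{i\in S}$ is a critical point in $\mathcal{C}^S_{\ge}$ of the function $f^S_{\mathrm{Nash}}:\mathbb{R}^S_{\ge 0}\to\mathbb{R}_{\ge 0}$ given by $f^S_{\mathrm{Nash}}(z)=\prod_{i\in S}z_i$, i.e. $c_S(x)\in\Gamma(f^S_{\mathrm{Nash}},\mathcal{C}^S_{\ge})$.
   Context: A public bads instance $(N,A,c)$ consists of agents $N=\{1,\dots,n\}$, a finite set $A$ of alternatives (bads), and cost functions $c_i:A\to\mathbb{R}_{\ge 0}$, $i\in N$. $\Delta(A)$ is the set of lotteries (allocations), i.e. probability vectors on $A$. Costs are extended linearly: $c_i(y)=\sum_{a\in A}y(a)c_i(a)$ for $y\in\mathbb{R}^A_{\ge0}$, and $c(y)=(c_i(y))_{i\in N}$. The cost set is $\mathcal{C}=\{c(x):x\in\Delta(A)\}$. Standing assumptions: $0\notin\mathcal{C}$ (every alternative has positive cost for some agent), and for every $i\in N$ there is $a\in A$ with $c_i(a)<\max_{a'\in A}c_i(a')$. Proportional fairness (PF): $x\in\Delta(A)$ is PF if $\frac1n\sum_{i\in N}\frac{c_i(y)}{c_i(x)}\ge 1$ for all $y\in\Delta(A)$, with conventions $0/0=1$ and $\alpha/0=+\infty$ for $\alpha>0$. Lindahl equilibrium: a pair $(x,p)$ with $x\in\Delta(A)$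 and personalized prices $p=(p_i:A\to\mathbb{R}_{\ge0})_{i\in N}$ such that (i) $p_i\cdot x\ge 1/n$ for all $i\in N$; (ii) for every $i\in N$ and $y\in\mathbb{R}^A_{\ge0}$ with $p_i\cdot y\ge 1/n$ we have $c_i(y)\ge c_i(x)$, and moreover if $c_i(y)=c_i(x)=0$ then $\sum_{a\in A}y(a)\ge1$; (iii) $\sum_{i\in N}p_i(a)\ge1$ for every $a\in A$, with equality if $x(a)>0$. Here $p_i\cdot y=\sum_{a\in A}p_i(a)y(a)$. $x$ is a Lindahl allocation if $(x,p)$ is a Lindahl equilibrium for some $p$. Upward closure: $\mathcal{C}_{\ge}=\{z\in\mathbb{R}^N_{\ge0}:\exists z'\in\mathcal{C}\text{ with }z\ge z'\text{ coordinatewise}\}$, and for $S\subseteq N$, $\mathcal{C}^S_{\ge}=\{(z_i)_{i\in S}: z\in\mathcal{C}_{\ge}\text{ and }z_i=0\ \forall i\in N\setminus S\}$. Critical points: for a smooth $f:\mathcal{X}\to\mathbb{R}$ and $\mathcal{Y}\subseteq\mathcal{X}$, $\Gamma(f,\mathcal{Y})$ is the set of $x\in\mathcal{Y}$ such that either $\nabla f(x)\cdot x\ge\nabla f(x)\cdot y$ for all $y\in\mathcal{Y}$, or $\nabla f(x)\cdot x\le\nabla f(x)\cdot y$ for all $y\in\mathcal{Y}$. *)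

theory Defs
  imports "HOL-Analysis.Analysis"
begin

text \<open>For a finite index set \<open>I\<close>, a vector of \<open>\<real>\<^sup>I\<close> is an extensional function on \<open>I\<close>
  (\<open>undefined\<close> off \<open>I\<close>), so that equality of vectors only concerns the coordinates in \<open>I\<close>.
  This gives access to \<open>\<real>\<^sup>S\<close> for a set \<open>S\<close> of agents that depends on the allocation.\<close>

definition nonneg_vectors :: "'i set \<Rightarrow> ('i \<Rightarrow> real) set" where
  "nonneg_vectors I = (I \<rightarrow>\<^sub>E {0..})"

definition dot :: "'i set \<Rightarrow> ('i \<Rightarrow> real) \<Rightarrow> ('i \<Rightarrow> real) \<Rightarrow> real" where
  "dot I v w = (\<Sum>i\<in>I. v i * w i)"

definition lotteries :: "'a set \<Rightarrow> ('a \<Rightarrow> real) set" where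
  "lotteries A = {x \<in> nonneg_vectors A. (\<Sum>a\<in>A. x a) = 1}"

definition agents :: "nat \<Rightarrow> nat set" where
  "agents n = {1..n}"

definition cost :: "'a set \<Rightarrow> (nat \<Rightarrow> 'a \<Rightarrow> real) \<Rightarrow> nat \<Rightarrow> ('a \<Rightarrow> real) \<Rightarrow> real" where
  "cost A c i y = (\<Sum>a\<in>A. y a * c i a)"

definition cost_vector ::
    "nat set \<Rightarrow> 'a set \<Rightarrow> (nat \<Rightarrow> 'a \<Rightarrow> real) \<Rightarrow> ('a \<Rightarrow> real) \<Rightarrow> (nat \<Rightarrow> real)" where
  "cost_vector S A c y = (\<lambda>i\<in>S. cost A c i y)"

definition cost_set :: "nat \<Rightarrow> 'a set \<Rightarrow> (nat \<Rightarrow> 'a \<Rightarrow> real) \<Rightarrow> (nat \<Rightarrow> real) set" where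
  "cost_set n A c = cost_vector (agents n) A c ` lotteries A"

definition public_bads_instance :: "nat \<Rightarrow> 'a set \<Rightarrow> (nat \<Rightarrow> 'a \<Rightarrow> real) \<Rightarrow> bool" where
  "public_bads_instance n A c \<longleftrightarrow>
     finite A \<and>
     (\<forall>i\<in>agents n. \<forall>a\<in>A. c i a \<ge> 0) \<and>
     (\<lambda>i\<in>agents n. 0) \<notin> cost_set n A c \<and>
     (\<forall>i\<in>agents n. \<exists>a\<in>A. c i a < Max (c i ` A))"

text \<open>The quotient \<open>\<alpha> / \<beta>\<close> of nonnegative reals, with \<open>0 / 0 = 1\<close> and \<open>\<alpha> / 0 = \<infinity>\<close> for \<open>\<alpha> > 0\<close>;
  division on \<^typ>\<open>ereal\<close> would give \<open>0 / 0 = 0\<close>.\<close>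

definition cost_ratio :: "real \<Rightarrow> real \<Rightarrow> ereal" where
  "cost_ratio \<alpha> \<beta> = (if \<beta> = 0 then (if \<alpha> = 0 then 1 else \<infinity>) else ereal (\<alpha> / \<beta>))"

definition proportionally_fair ::
    "nat \<Rightarrow> 'a set \<Rightarrow> (nat \<Rightarrow> 'a \<Rightarrow> real) \<Rightarrow> ('a \<Rightarrow> real) \<Rightarrow> bool" where
  "proportionally_fair n A c x \<longleftrightarrow>
     x \<in> lotteries A \<and>
     (\<forall>y\<in>lotteries A.
        ereal (1 / real n) * (\<Sum>i\<in>agents n. cost_ratio (cost A c i y) (cost A c i x)) \<ge> 1)"

definition lindahl_equilibrium ::
    "nat \<Rightarrow> 'a set \<Rightarrow> (nat \<Rightarrow> 'a \<Rightarrow> real) \<Rightarrow> ('a \<Rightarrow> real) \<Rightarrow> (nat \<Rightarrow> 'a \<Rightarrow> real) \<Rightarrow> bool" where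
  "lindahl_equilibrium n A c x p \<longleftrightarrow>
     x \<in> lotteries A \<and>
     (\<forall>i\<in>agents n. p i \<in> nonneg_vectors A) \<and>
     (\<forall>i\<in>agents n. dot A (p i) x \<ge> 1 / real n) \<and>
     (\<forall>i\<in>agents n. \<forall>y\<in>nonneg_vectors A. dot A (p i) y \<ge> 1 / real n \<longrightarrow>
        cost A c i y \<ge> cost A c i x \<and>
        (cost A c i y = 0 \<and> cost A c i x = 0 \<longrightarrow> (\<Sum>a\<in>A. y a) \<ge> 1)) \<and>
     (\<forall>a\<in>A. (\<Sum>i\<in>agents n. p i a) \<ge> 1 \<and>
        (x a > 0 \<longrightarrow> (\<Sum>i\<in>agents n. p i a) = 1))"

definition lindahl_allocation ::
    "nat \<Rightarrow> 'a set \<Rightarrow> (nat \<Rightarrow> 'a \<Rightarrow> real) \<Rightarrow> ('a \<Rightarrow> real) \<Rightarrow> bool" where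
  "lindahl_allocation n A c x \<longleftrightarrow> (\<exists>p. lindahl_equilibrium n A c x p)"

definition upward_cost_set :: "nat \<Rightarrow> 'a set \<Rightarrow> (nat \<Rightarrow> 'a \<Rightarrow> real) \<Rightarrow> (nat \<Rightarrow> real) set" where
  "upward_cost_set n A c =
     {z \<in> nonneg_vectors (agents n). \<exists>z'\<in>cost_set n A c. \<forall>i\<in>agents n. z i \<ge> z' i}"

definition upward_cost_set_on ::
    "nat \<Rightarrow> 'a set \<Rightarrow> (nat \<Rightarrow> 'a \<Rightarrow> real) \<Rightarrow> nat set \<Rightarrow> (nat \<Rightarrow> real) set" where
  "upward_cost_set_on n A c S =
     (\<lambda>z. restrict z S) ` {z \<in> upward_cost_set n A c. \<forall>i\<in>agents n - S. z i = 0}"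

text \<open>The gradient of \<open>f : X \<rightarrow> \<real>\<close>, \<open>X \<subseteq> \<real>\<^sup>I\<close>, is the vector of partial derivatives. Each is taken
  within the domain \<open>X\<close>, hence one-sided at boundary points of \<open>X\<close>, so that values of \<open>f\<close> off \<open>X\<close>
  do not matter. The definition is meant for smooth \<open>f\<close> only: where a partial derivative does not
  exist, \<^const>\<open>vector_derivative\<close> is an unspecified value.\<close>

definition gradient :: "'i set \<Rightarrow> (('i \<Rightarrow> real) \<Rightarrow> real) \<Rightarrow> ('i \<Rightarrow> real) set \<Rightarrow> ('i \<Rightarrow> real) \<Rightarrow> ('i \<Rightarrow> real)"
  where
  "gradient I f X x =
     (\<lambda>i\<in>I. vector_derivative (\<lambda>t. f (x(i := t))) (at (x i) within {t. x(i := t) \<in> X}))"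

definition critical_points ::
    "'i set \<Rightarrow> (('i \<Rightarrow> real) \<Rightarrow> real) \<Rightarrow> ('i \<Rightarrow> real) set \<Rightarrow> ('i \<Rightarrow> real) set \<Rightarrow> ('i \<Rightarrow> real) set" where
  "critical_points I f X Y =
     {x \<in> Y. (\<forall>y\<in>Y. dot I (gradient I f X x) x \<ge> dot I (gradient I f X x) y) \<or>
             (\<forall>y\<in>Y. dot I (gradient I f X x) x \<le> dot I (gradient I f X x) y)}"

definition nash :: "'i set \<Rightarrow> ('i \<Rightarrow> real) \<Rightarrow> real" where
  "nash S z = (\<Prod>i\<in>S. z i)"

end

(* Write T for the agents outside S. All three conditions say that
   sum_{i in S} c_i(a) / c_i(x) >= |S| for every alternative a that is free for all agents in T.
   For (1), a lottery with positive cost for some agent in T has infinite cost ratio, and the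
   other lotteries are mixtures of such a. For (3), the gradient of the Nash product at c_S(x) is
   proportional to (1 / c_i(x))_{i in S}; c_S(x) cannot maximize the linear form
   because the upward closure is unbounded. For (2), the prices are p_i(a) = c_i(a) / (n c_i(x))
   for i in S, while for i in T they are 1/n on alternatives free for i and 1 elsewhere. *)
theory Submission
  imports Defs
begin

section \<open>Lotteries and point masses\<close>

lemma nonneg_vectors_nonneg: "y \<in> nonneg_vectors A \<Longrightarrow> a \<in> A \<Longrightarrow> y a \<ge> 0"
  by (auto simp: nonneg_vectors_def)

lemma lotteries_nonneg: "y \<in> lotteries A \<Longrightarrow> a \<in> A \<Longrightarrow> y a \<ge> 0"
  by (auto simp: lotteries_def nonneg_vectors_nonneg)

lemma lotteries_sum: "y \<in> lotteries A \<Longrightarrow> (\<Sum>a\<in>A. y a) = 1"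
  by (auto simp: lotteries_def)

text \<open>The mass \<open>t\<close> is left free: \<open>t = 1\<close> gives a lottery, while a
  Lindahl demand on one alternative needs a mass that depends on its price.\<close>

definition point_mass :: "'a set \<Rightarrow> 'a \<Rightarrow> real \<Rightarrow> 'a \<Rightarrow> real" where
  "point_mass A b t = (\<lambda>a\<in>A. if a = b then t else 0)"

lemma point_mass_nonneg: "t \<ge> 0 \<Longrightarrow> point_mass A b t \<in> nonneg_vectors A"
  by (auto simp: point_mass_def nonneg_vectors_def)

lemma sum_point_mass_mult:
  assumes "finite A" "b \<in> A"
  shows "(\<Sum>a\<in>A. point_mass A b t a * f a) = t * f b"
proof -
  have "(\<Sum>a\<in>A. point_mass A b t a * f a) = (\<Sum>a\<in>A. if a = b then t * f a else 0)"
    by (rule sum.cong) (auto simp: point_mass_def)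
  then show ?thesis using assms by simp
qed

lemma sum_point_mass:
  assumes "finite A" "b \<in> A"
  shows "(\<Sum>a\<in>A. point_mass A b t a) = t"
  using sum_point_mass_mult[OF assms, of t "\<lambda>_. 1"] by simp

lemma cost_point_mass:
  "finite A \<Longrightarrow> b \<in> A \<Longrightarrow> cost A c i (point_mass A b t) = t * c i b"
  by (simp add: cost_def sum_point_mass_mult)

lemma dot_point_mass:
  "finite A \<Longrightarrow> b \<in> A \<Longrightarrow> dot A p (point_mass A b t) = t * p b"
  using sum_point_mass_mult[of A b t p] by (simp add: dot_def mult.commute)

lemma point_mass_lottery:
  "finite A \<Longrightarrow> b \<in> A \<Longrightarrow> point_mass A b 1 \<in> lotteries A"
  by (simp add: lotteries_def point_mass_nonneg sum_point_mass)

section \<open>The gradient of the Nash product\<close>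

lemma gradient_nash:
  assumes "finite S" and pos: "\<And>i. i \<in> S \<Longrightarrow> z i > 0" and ext: "z \<in> extensional S"
    and i: "i \<in> S"
  shows "gradient S (nash S) (nonneg_vectors S) z i = nash S z / z i"
proof -
  let ?D = "{t. z(i := t) \<in> nonneg_vectors S}"
  have D: "?D = {0..}"
    using pos i ext
    by (force simp: nonneg_vectors_def PiE_def extensional_def Pi_def less_imp_le)
  \<comment> \<open>The product is linear in each single coordinate, so the partial derivative is
    the product of the others.\<close>
  have nash_upd: "nash S (z(i := t)) = t * (\<Prod>j\<in>S - {i}. z j)" for t
    unfolding nash_def using assms(1) i by (subst prod.remove[of _ i]) auto
  \<comment> \<open>Positivity keeps \<open>z i\<close> off the boundary, so the derivative within
    the domain is the ordinary two-sided one.\<close>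
  have int: "z i \<in> interior ?D"
    unfolding D using pos[OF i] by simp
  have "((\<lambda>t. nash S (z(i := t))) has_vector_derivative (\<Prod>j\<in>S - {i}. z j)) (at (z i))"
    unfolding nash_upd by (auto intro!: derivative_eq_intros)
  then have "vector_derivative (\<lambda>t. nash S (z(i := t))) (at (z i) within ?D)
      = (\<Prod>j\<in>S - {i}. z j)"
    using at_within_interior[OF int] by (simp add: vector_derivative_at)
  also have "\<dots> = nash S z / z i"
    using nash_upd[of "z i"] pos[OF i] by (simp add: field_simps)
  finally show ?thesis using i by (simp add: gradient_def)
qed

section \<open>Agents with positive and with zero cost at \<open>x\<close>\<close>

locale public_bads =
  fixes n :: nat and A :: "'a set" and c :: "nat \<Rightarrow> 'a \<Rightarrow> real" and x :: "'a \<Rightarrow> real"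
  assumes bads: "public_bads_instance n A c"
    and x: "x \<in> lotteries A"
begin

definition S :: "nat set" where
  "S = {i \<in> agents n. cost A c i x > 0}"

definition T :: "nat set" where
  "T = agents n - S"

definition locally_fair :: bool where
  "locally_fair \<longleftrightarrow>
     (\<forall>a\<in>A. (\<forall>i\<in>T. c i a = 0) \<longrightarrow> (\<Sum>i\<in>S. c i a / cost A c i x) \<ge> real (card S))"

lemma finite_A: "finite A"
  and c_nonneg: "i \<in> agents n \<Longrightarrow> a \<in> A \<Longrightarrow> c i a \<ge> 0"
  and zero_notin_cost_set: "(\<lambda>i\<in>agents n. 0) \<notin> cost_set n A c"
  using bads by (auto simp: public_bads_instance_def)

lemma finite_agents: "finite (agents n)" "finite S" "finite T"
  by (auto simp: agents_def S_def T_def)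

lemma S_agents: "i \<in> S \<Longrightarrow> i \<in> agents n" and T_agents: "i \<in> T \<Longrightarrow> i \<in> agents n"
  by (auto simp: S_def T_def)

lemma sum_agents: "(\<Sum>i\<in>agents n. f i) = (\<Sum>i\<in>S. f i) + (\<Sum>i\<in>T. f i)"
  for f :: "nat \<Rightarrow> 'b :: comm_monoid_add"
proof -
  have "agents n = S \<union> T" "S \<inter> T = {}" by (auto simp: S_def T_def)
  then show ?thesis
    using finite_agents by (simp add: sum.union_disjoint)
qed

lemma card_agents: "real (card S) + real (card T) = real n"
  using sum_agents[of "\<lambda>_. 1 :: real"] by (simp add: agents_def)

lemma cost_nonneg: "i \<in> agents n \<Longrightarrow> y \<in> nonneg_vectors A \<Longrightarrow> cost A c i y \<ge> 0"
  by (simp add: cost_def sum_nonneg nonneg_vectors_nonneg c_nonneg)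

lemma x_nonneg_vectors: "x \<in> nonneg_vectors A"
  using x by (simp add: lotteries_def)

lemma cost_S: "i \<in> S \<Longrightarrow> cost A c i x > 0"
  by (simp add: S_def)

lemma cost_T: "i \<in> T \<Longrightarrow> cost A c i x = 0"
  using cost_nonneg[OF _ x_nonneg_vectors, of i] by (auto simp: S_def T_def)

lemma cost_zero_support:
  assumes "i \<in> agents n" "y \<in> nonneg_vectors A" "cost A c i y = 0" "a \<in> A"
  shows "y a = 0 \<or> c i a = 0"
proof -
  have "\<forall>a\<in>A. y a * c i a = 0"
    using assms(3) unfolding cost_def
    by (subst (asm) sum_nonneg_eq_0_iff)
       (auto simp: finite_A nonneg_vectors_nonneg[OF assms(2)] c_nonneg[OF assms(1)])
  then show ?thesis using assms(4) by simp
qed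

text \<open>This is where the assumption that 0 is not in the cost set enters. It yields
  \<open>n > 0\<close> and \<open>card S > 0\<close>.\<close>

lemma S_nonempty: "S \<noteq> {}"
proof
  assume "S = {}"
  then have "cost A c i x = 0" if "i \<in> agents n" for i
    using that cost_T by (auto simp: T_def)
  then have "cost_vector (agents n) A c x = (\<lambda>i\<in>agents n. 0)"
    by (auto simp: cost_vector_def)
  then show False
    using zero_notin_cost_set x by (metis cost_set_def imageI)
qed

lemma card_S_pos: "card S > 0"
  using S_nonempty finite_agents by (simp add: card_gt_0_iff)

lemma n_pos: "n > 0"
  using S_nonempty by (auto simp: S_def agents_def)

text \<open>A lottery free for all of \<open>T\<close> puts weight only on alternatives free for all
  of \<open>T\<close>, so the inequalities for those alternatives can be averaged with weights
  \<open>y\<close>.\<close>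

lemma locally_fair_lottery:
  assumes "locally_fair" and y: "y \<in> lotteries A" and T0: "\<And>i. i \<in> T \<Longrightarrow> cost A c i y = 0"
  shows "(\<Sum>i\<in>S. cost A c i y / cost A c i x) \<ge> real (card S)"
proof -
  have yn: "y \<in> nonneg_vectors A" using y by (simp add: lotteries_def)
  have "real (card S) = (\<Sum>a\<in>A. y a * real (card S))"
    using lotteries_sum[OF y] by (simp flip: sum_distrib_right)
  also have "\<dots> \<le> (\<Sum>a\<in>A. y a * (\<Sum>i\<in>S. c i a / cost A c i x))"
  proof (rule sum_mono)
    fix a assume a: "a \<in> A"
    show "y a * real (card S) \<le> y a * (\<Sum>i\<in>S. c i a / cost A c i x)"
    proof (cases "y a = 0")
      case False
      then have "\<forall>i\<in>T. c i a = 0"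
        using cost_zero_support[OF T_agents yn T0 a] by auto
      then show ?thesis
        using assms(1) a lotteries_nonneg[OF y a]
        by (intro mult_left_mono) (auto simp: locally_fair_def)
    qed simp
  qed
  also have "\<dots> = (\<Sum>a\<in>A. \<Sum>i\<in>S. y a * c i a / cost A c i x)"
    by (simp add: sum_distrib_left)
  also have "\<dots> = (\<Sum>i\<in>S. cost A c i y / cost A c i x)"
    by (subst sum.swap) (simp add: cost_def sum_divide_distrib)
  finally show ?thesis .
qed

section \<open>Proportional fairness\<close>

text \<open>Each agent in \<open>T\<close> contributes 0/0 = 1. Since
  \<open>card S + card T = n\<close>, the bound \<open>n\<close> on the whole sum becomes the bound
  \<open>card S\<close> on the sum over \<open>S\<close>.\<close>

lemma cost_ratio_sum_free:
  assumes "\<And>i. i \<in> T \<Longrightarrow> cost A c i y = 0"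
  shows "(\<Sum>i\<in>agents n. cost_ratio (cost A c i y) (cost A c i x))
    = ereal ((\<Sum>i\<in>S. cost A c i y / cost A c i x) + real (card T))"
proof -
  have "(\<Sum>i\<in>agents n. cost_ratio (cost A c i y) (cost A c i x))
     = (\<Sum>i\<in>S. ereal (cost A c i y / cost A c i x)) + (\<Sum>i\<in>T. ereal 1)"
    unfolding sum_agents using cost_S cost_T assms
    by (intro arg_cong2[where f = "(+)"] sum.cong)
       (force simp: cost_ratio_def one_ereal_def)+
  then show ?thesis by (simp only: sum_ereal plus_ereal.simps) simp
qed

lemma cost_ratio_sum_infinite:
  assumes "y \<in> nonneg_vectors A" "i \<in> T" "cost A c i y \<noteq> 0"
  shows "(\<Sum>i\<in>agents n. cost_ratio (cost A c i y) (cost A c i x)) = \<infinity>"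
proof -
  have "cost_ratio (cost A c i y) (cost A c i x) = \<infinity>"
    using assms cost_T by (simp add: cost_ratio_def)
  \<comment> \<open>No summand is minus infinity, so a single infinite ratio decides the
    sum.\<close>
  moreover have "cost_ratio (cost A c j y) (cost A c j x) \<noteq> -\<infinity>" for j
    by (simp add: cost_ratio_def)
  ultimately show ?thesis
    using T_agents[OF assms(2)] finite_agents by (subst sum_Pinfty) auto
qed

lemma proportionally_fair_iff: "proportionally_fair n A c x \<longleftrightarrow> locally_fair"
proof
  assume pf: "proportionally_fair n A c x"
  show locally_fair
    unfolding locally_fair_def
  proof (intro ballI impI)
    fix a assume a: "a \<in> A" and free: "\<forall>i\<in>T. c i a = 0"
    let ?y = "point_mass A a 1"
    have cy: "cost A c i ?y = c i a" for i
      using cost_point_mass[OF finite_A a, of c i 1] by simp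
    have "1 \<le> ereal (1 / real n) *
        (\<Sum>i\<in>agents n. cost_ratio (cost A c i ?y) (cost A c i x))"
      using pf point_mass_lottery[OF finite_A a] unfolding proportionally_fair_def by blast
    then have "1 \<le> (1 / real n) * ((\<Sum>i\<in>S. c i a / cost A c i x) + real (card T))"
      using free by (subst (asm) cost_ratio_sum_free) (auto simp: cy)
    then show "real (card S) \<le> (\<Sum>i\<in>S. c i a / cost A c i x)"
      using n_pos card_agents by (simp add: field_simps)
  qed
next
  assume lf: locally_fair
  show "proportionally_fair n A c x"
    unfolding proportionally_fair_def
  proof (intro conjI x ballI)
    fix y assume y: "y \<in> lotteries A"
    show "1 \<le> ereal (1 / real n) *
        (\<Sum>i\<in>agents n. cost_ratio (cost A c i y) (cost A c i x))"
    proof (cases "\<forall>i\<in>T. cost A c i y = 0")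
      case True
      then have "real n \<le> (\<Sum>i\<in>S. cost A c i y / cost A c i x) + real (card T)"
        using locally_fair_lottery[OF lf y] card_agents by simp
      then have "1 \<le> (1 / real n) * ((\<Sum>i\<in>S. cost A c i y / cost A c i x) + real (card T))"
        using n_pos by (simp add: field_simps)
      then show ?thesis
        using True by (subst cost_ratio_sum_free) auto
    next
      case False
      then have "(\<Sum>i\<in>agents n. cost_ratio (cost A c i y) (cost A c i x)) = \<infinity>"
        using cost_ratio_sum_infinite y by (auto simp: lotteries_def)
      \<comment> \<open>Positivity of \<open>n\<close> matters: \<open>0 * \<infinity>\<close> is 0
        in \<open>ereal\<close>.\<close>
      then show ?thesis using n_pos by simp
    qed
  qed
qed

section \<open>Lindahl equilibria\<close>

text \<open>Optimality of \<open>x\<close> bounds the prices of a free alternative from above: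
  \<open>n * p i a\<close> is at most the cost ratio for \<open>i\<close> in \<open>S\<close> and at
  most 1 for \<open>i\<close> in \<open>T\<close>. Since the prices of \<open>a\<close> sum to at
  least 1, the ratios must sum to at least \<open>n - card T\<close>.\<close>

lemma lindahl_imp_locally_fair:
  assumes "lindahl_equilibrium n A c x p"
  shows locally_fair
  unfolding locally_fair_def
proof (intro ballI impI)
  fix a assume a: "a \<in> A" and free: "\<forall>i\<in>T. c i a = 0"
  have p_nonneg: "p i a \<ge> 0" if "i \<in> agents n" for i
    using assms that a by (auto simp: lindahl_equilibrium_def intro: nonneg_vectors_nonneg)
  \<comment> \<open>Spending exactly \<open>1 / n\<close> on \<open>a\<close> alone bounds the price of \<open>a\<close>.\<close>
  have opt: "cost A c i x \<le> c i a / (real n * p i a)"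
      "c i a = 0 \<Longrightarrow> cost A c i x = 0 \<Longrightarrow> 1 / (real n * p i a) \<ge> 1"
    if i: "i \<in> agents n" and pos: "p i a > 0" for i
  proof -
    let ?y = "point_mass A a (1 / (real n * p i a))"
    have y: "?y \<in> nonneg_vectors A"
      using pos by (intro point_mass_nonneg) simp
    have "dot A (p i) ?y \<ge> 1 / real n"
      using pos n_pos by (simp add: dot_point_mass finite_A a)
    then have "cost A c i x \<le> cost A c i ?y \<and>
        (cost A c i ?y = 0 \<and> cost A c i x = 0 \<longrightarrow> (\<Sum>a\<in>A. ?y a) \<ge> 1)"
      using assms i y unfolding lindahl_equilibrium_def by blast
    then show "cost A c i x \<le> c i a / (real n * p i a)"
      "c i a = 0 \<Longrightarrow> cost A c i x = 0 \<Longrightarrow> 1 / (real n * p i a) \<ge> 1"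
      by (simp_all add: cost_point_mass sum_point_mass finite_A a)
  qed
  have "real n * p i a \<le> c i a / cost A c i x" if i: "i \<in> S" for i
  proof (cases "p i a > 0")
    case True
    then show ?thesis
      using opt(1)[OF S_agents[OF i] True] cost_S[OF i] n_pos by (simp add: field_simps)
  next
    \<comment> \<open>At price zero no amount of \<open>a\<close> alone meets the budget, so
      optimality gives no bound here; nonnegativity of costs suffices.\<close>
    case False
    then have "p i a = 0" using p_nonneg[OF S_agents[OF i]] by simp
    then show ?thesis using c_nonneg[OF S_agents[OF i] a] cost_S[OF i] by simp
  qed
  then have bS: "(\<Sum>i\<in>S. real n * p i a) \<le> (\<Sum>i\<in>S. c i a / cost A c i x)"
    by (rule sum_mono)
  have "real n * p i a \<le> 1" if i: "i \<in> T" for i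
  proof (cases "p i a > 0")
    case True
    then show ?thesis
      using opt(2)[OF T_agents[OF i] True] cost_T[OF i] free i n_pos by (simp add: field_simps)
  next
    case False
    then have "p i a = 0" using p_nonneg[OF T_agents[OF i]] by simp
    then show ?thesis by simp
  qed
  then have "(\<Sum>i\<in>T. real n * p i a) \<le> (\<Sum>i\<in>T. 1)"
    by (rule sum_mono)
  moreover have "(\<Sum>i\<in>agents n. p i a) \<ge> 1"
    using assms a by (simp add: lindahl_equilibrium_def)
  then have "real n \<le> real n * (\<Sum>i\<in>agents n. p i a)"
    using n_pos by simp
  ultimately show "real (card S) \<le> (\<Sum>i\<in>S. c i a / cost A c i x)"
    using bS card_agents by (simp add: sum_agents distrib_left flip: sum_distrib_left)
qed

text \<open>On \<open>S\<close> the costs are scaled so that \<open>x\<close> meets the budget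
  exactly. On \<open>T\<close> the value \<open>1 / n\<close> turns the budget condition for
  cost-free bundles into total mass at least 1, and the value 1 lets one such agent alone carry the
  price of a non-free alternative.\<close>

definition price :: "nat \<Rightarrow> 'a \<Rightarrow> real" where
  "price i = (\<lambda>a\<in>A. if i \<in> S then c i a / (real n * cost A c i x)
     else if c i a = 0 then 1 / real n else 1)"

lemma price_nonneg: "i \<in> agents n \<Longrightarrow> a \<in> A \<Longrightarrow> price i a \<ge> 0"
  using c_nonneg cost_S by (auto simp: price_def less_imp_le)

lemma dot_price_S: "i \<in> S \<Longrightarrow> dot A (price i) y = cost A c i y / (real n * cost A c i x)"
  by (auto simp: dot_def price_def cost_def sum_divide_distrib mult.commute intro!: sum.cong)

lemma dot_price_T:
  assumes "i \<in> T" "y \<in> nonneg_vectors A" "cost A c i y = 0"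
  shows "dot A (price i) y = (\<Sum>a\<in>A. y a) / real n"
  unfolding dot_def sum_divide_distrib
proof (rule sum.cong)
  fix a assume a: "a \<in> A"
  then show "price i a * y a = y a / real n"
    using assms(1) cost_zero_support[OF T_agents[OF assms(1)] assms(2,3) a]
    by (auto simp: price_def T_def)
qed simp

lemma dot_price_x: "i \<in> agents n \<Longrightarrow> dot A (price i) x = 1 / real n"
proof (cases "i \<in> S")
  case True
  then show ?thesis using cost_S[OF True] by (simp add: dot_price_S)
next
  case False
  moreover assume "i \<in> agents n"
  ultimately have "i \<in> T" by (simp add: T_def)
  then show ?thesis
    using dot_price_T[OF _ x_nonneg_vectors] cost_T lotteries_sum[OF x] by simp
qed

text \<open>If \<open>a\<close> is free for \<open>T\<close>, the bound is local fairness divided by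
  \<open>n\<close>; otherwise some agent in \<open>T\<close> already has price 1.\<close>

lemma sum_price_ge_1:
  assumes locally_fair and a: "a \<in> A"
  shows "(\<Sum>i\<in>agents n. price i a) \<ge> 1"
proof (cases "\<forall>i\<in>T. c i a = 0")
  case True
  have "(\<Sum>i\<in>agents n. price i a)
      = (\<Sum>i\<in>S. c i a / cost A c i x / real n) + (\<Sum>i\<in>T. 1 / real n)"
    unfolding sum_agents using True a
    by (intro arg_cong2[where f = "(+)"] sum.cong) (auto simp: price_def T_def)
  also have "\<dots> = ((\<Sum>i\<in>S. c i a / cost A c i x) + real (card T)) / real n"
    by (simp add: add_divide_distrib sum_divide_distrib)
  also have "\<dots> \<ge> 1"
    using assms True card_agents n_pos by (auto simp: locally_fair_def field_simps)
  finally show ?thesis .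
next
  case False
  then obtain i where i: "i \<in> T" "c i a \<noteq> 0" by auto
  then have "1 = price i a" using a by (simp add: price_def T_def)
  also have "\<dots> \<le> (\<Sum>i\<in>agents n. price i a)"
    using i T_agents a by (intro member_le_sum) (auto simp: price_nonneg finite_agents)
  finally show ?thesis .
qed

text \<open>Agents spend \<open>1 / n\<close> each at \<open>x\<close>, so the average total price under \<open>x\<close> is \<open>1\<close>.\<close>

lemma sum_price_eq_1:
  assumes locally_fair and a: "a \<in> A" "x a > 0"
  shows "(\<Sum>i\<in>agents n. price i a) = 1"
proof -
  \<comment> \<open>The weighted excesses over 1 are nonnegative and sum to zero, so each
    vanishes.\<close>
  let ?e = "\<lambda>a. x a * ((\<Sum>i\<in>agents n. price i a) - 1)"
  have "(\<Sum>a\<in>A. x a * (\<Sum>i\<in>agents n. price i a)) = (\<Sum>i\<in>agents n. dot A (price i) x)"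
    unfolding dot_def sum_distrib_left by (subst sum.swap) (simp add: mult.commute)
  also have "\<dots> = 1"
    using n_pos by (simp add: dot_price_x agents_def)
  finally have "(\<Sum>a\<in>A. ?e a) = 0"
    using lotteries_sum[OF x] by (simp add: right_diff_distrib sum_subtractf)
  moreover have "\<forall>a\<in>A. ?e a \<ge> 0"
    using sum_price_ge_1[OF assms(1)] lotteries_nonneg[OF x] by simp
  ultimately have "?e a = 0"
    using finite_A a by (subst (asm) sum_nonneg_eq_0_iff) auto
  then show ?thesis using a by simp
qed

lemma price_demand:
  assumes i: "i \<in> agents n" and y: "y \<in> nonneg_vectors A" and afford: "dot A (price i) y \<ge> 1 / real n"
  shows "cost A c i y \<ge> cost A c i x \<and>
    (cost A c i y = 0 \<and> cost A c i x = 0 \<longrightarrow> (\<Sum>a\<in>A. y a) \<ge> 1)"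
proof (cases "i \<in> S")
  case True
  then show ?thesis
    using afford cost_S[OF True] n_pos by (simp add: dot_price_S field_simps)
next
  case False
  then have "i \<in> T" using i by (simp add: T_def)
  then show ?thesis
    using afford n_pos cost_T cost_nonneg[OF i y] dot_price_T[OF _ y]
    by (auto simp: field_simps)
qed

lemma locally_fair_imp_lindahl:
  assumes locally_fair
  shows "lindahl_equilibrium n A c x price"
proof -
  have "price i \<in> nonneg_vectors A" if "i \<in> agents n" for i
    using price_nonneg[OF that] by (auto simp: nonneg_vectors_def price_def)
  then show ?thesis
    unfolding lindahl_equilibrium_def
    using x dot_price_x price_demand sum_price_ge_1[OF assms] sum_price_eq_1[OF assms] by auto
qed

lemma lindahl_allocation_iff: "lindahl_allocation n A c x \<longleftrightarrow> locally_fair"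
  using lindahl_imp_locally_fair locally_fair_imp_lindahl by (auto simp: lindahl_allocation_def)

section \<open>Critical points of the Nash product\<close>

lemma upward_cost_set_on_memI:
  assumes "y \<in> lotteries A" "\<And>i. i \<in> T \<Longrightarrow> cost A c i y = 0"
    and "z \<in> extensional S" "\<And>i. i \<in> S \<Longrightarrow> z i \<ge> cost A c i y"
  shows "z \<in> upward_cost_set_on n A c S"
proof -
  \<comment> \<open>Extension by zero on \<open>T\<close> still dominates the costs of
    \<open>y\<close>, which vanish there.\<close>
  let ?z = "\<lambda>i\<in>agents n. if i \<in> S then z i else 0"
  have yn: "y \<in> nonneg_vectors A" using assms(1) by (simp add: lotteries_def)
  have "z i \<ge> 0" if "i \<in> S" for i
    using assms(4)[OF that] cost_nonneg[OF S_agents[OF that] yn] by simp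
  then have "?z \<in> nonneg_vectors (agents n)"
    by (auto simp: nonneg_vectors_def)
  moreover have "\<forall>i\<in>agents n. ?z i \<ge> cost_vector (agents n) A c y i"
    using assms by (auto simp: cost_vector_def T_def)
  then have "\<exists>z'\<in>cost_set n A c. \<forall>i\<in>agents n. ?z i \<ge> z' i"
    unfolding cost_set_def using assms(1) by blast
  ultimately have "?z \<in> {z \<in> upward_cost_set n A c. \<forall>i\<in>agents n - S. z i = 0}"
    by (simp add: upward_cost_set_def)
  moreover have "z = restrict ?z S"
    using assms(3) S_agents by (auto simp: extensional_def restrict_def)
  ultimately show ?thesis
    unfolding upward_cost_set_on_def by blast
qed

lemma upward_cost_set_onE:
  assumes "z \<in> upward_cost_set_on n A c S"
  obtains y where "y \<in> lotteries A" "\<And>i. i \<in> T \<Longrightarrow> cost A c i y = 0"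
    "\<And>i. i \<in> S \<Longrightarrow> z i \<ge> cost A c i y"
proof -
  obtain w y where zw: "z = restrict w S" and w0: "\<forall>i\<in>T. w i = 0" and y: "y \<in> lotteries A"
    and "\<forall>i\<in>agents n. w i \<ge> cost_vector (agents n) A c y i"
    using assms unfolding upward_cost_set_on_def upward_cost_set_def cost_set_def T_def by auto
  then have wy: "w i \<ge> cost A c i y" if "i \<in> agents n" for i
    using that by (auto simp: cost_vector_def)
  have yn: "y \<in> nonneg_vectors A" using y by (simp add: lotteries_def)
  show ?thesis
  proof
    show "y \<in> lotteries A" by (rule y)
    \<comment> \<open>The cost is squeezed between 0 and \<open>w i = 0\<close>.\<close>
    show "cost A c i y = 0" if "i \<in> T" for i
      using wy[OF T_agents[OF that]] w0 that cost_nonneg[OF T_agents[OF that] yn] by force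
    show "z i \<ge> cost A c i y" if "i \<in> S" for i
      using wy[OF S_agents[OF that]] that zw by simp
  qed
qed

lemma dot_gradient_nash:
  "dot S (gradient S (nash S) (nonneg_vectors S) (cost_vector S A c x)) z
     = nash S (cost_vector S A c x) * (\<Sum>i\<in>S. z i / cost A c i x)"
proof -
  have "gradient S (nash S) (nonneg_vectors S) (cost_vector S A c x) i
      = nash S (cost_vector S A c x) / cost A c i x" if "i \<in> S" for i
    using that cost_S finite_agents by (subst gradient_nash) (auto simp: cost_vector_def)
  then show ?thesis
    by (simp add: dot_def sum_distrib_left)
qed

text \<open>The positive factor \<open>nash S\<close> cancels from the gradient, leaving a linear
  form with value \<open>card S\<close> at the cost vector of \<open>x\<close>. Only the minimum
  alternative of criticality can hold.\<close>

lemma critical_iff: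
  "cost_vector S A c x \<in> critical_points S (nash S) (nonneg_vectors S) (upward_cost_set_on n A c S)
     \<longleftrightarrow> (\<forall>z\<in>upward_cost_set_on n A c S. real (card S) \<le> (\<Sum>i\<in>S. z i / cost A c i x))"
proof -
  let ?U = "upward_cost_set_on n A c S" and ?v = "cost_vector S A c x"
  let ?r = "\<lambda>z. \<Sum>i\<in>S. z i / cost A c i x"
  have pos: "nash S ?v > 0"
    using cost_S by (auto simp: nash_def cost_vector_def intro!: prod_pos)
  have rv: "?r ?v = real (card S)"
    using cost_S by (simp add: cost_vector_def less_imp_neq[symmetric])
  have v: "?v \<in> ?U"
    by (rule upward_cost_set_on_memI[OF x]) (auto simp: cost_T cost_vector_def)
  \<comment> \<open>Doubling the cost vector stays in the upward closure and doubles the form, which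
    excludes a maximum because \<open>card S > 0\<close>.\<close>
  let ?w = "\<lambda>i\<in>S. 2 * cost A c i x"
  have "?w \<in> ?U"
    using cost_S by (intro upward_cost_set_on_memI[OF x]) (auto simp: cost_T less_imp_le)
  moreover have "?r ?w = 2 * real (card S)"
    using cost_S by (simp add: less_imp_neq[symmetric])
  ultimately have "\<exists>z\<in>?U. \<not> ?r z \<le> ?r ?v"
    using card_S_pos rv by (intro bexI[of _ ?w]) simp_all
  then show ?thesis
    using v by (simp add: critical_points_def dot_gradient_nash rv mult_le_cancel_left_pos[OF pos])
      blast
qed

text \<open>Forwards, the point masses on free alternatives serve as test points. Backwards, every
  \<open>z\<close> dominates the costs of a lottery free for \<open>T\<close>, and the form is
  monotone.\<close>

lemma critical_iff_locally_fair:
  "cost_vector S A c x \<in> critical_points S (nash S) (nonneg_vectors S) (upward_cost_set_on n A c S)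
     \<longleftrightarrow> locally_fair"
  unfolding critical_iff
proof
  assume crit: "\<forall>z\<in>upward_cost_set_on n A c S. real (card S) \<le> (\<Sum>i\<in>S. z i / cost A c i x)"
  show locally_fair
    unfolding locally_fair_def
  proof (intro ballI impI)
    fix a assume a: "a \<in> A" and free: "\<forall>i\<in>T. c i a = 0"
    have "(\<lambda>i\<in>S. c i a) \<in> upward_cost_set_on n A c S"
      using free
      by (intro upward_cost_set_on_memI[OF point_mass_lottery[OF finite_A a]])
         (auto simp: cost_point_mass finite_A a)
    then show "real (card S) \<le> (\<Sum>i\<in>S. c i a / cost A c i x)"
      using crit by force
  qed
next
  assume lf: locally_fair
  show "\<forall>z\<in>upward_cost_set_on n A c S. real (card S) \<le> (\<Sum>i\<in>S. z i / cost A c i x)"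
  proof
    fix z assume "z \<in> upward_cost_set_on n A c S"
    then obtain y where y: "y \<in> lotteries A" "\<And>i. i \<in> T \<Longrightarrow> cost A c i y = 0"
      and le: "\<And>i. i \<in> S \<Longrightarrow> cost A c i y \<le> z i"
      by (rule upward_cost_set_onE) blast
    have "real (card S) \<le> (\<Sum>i\<in>S. cost A c i y / cost A c i x)"
      by (rule locally_fair_lottery[OF lf y])
    also have "\<dots> \<le> (\<Sum>i\<in>S. z i / cost A c i x)"
      using le cost_S by (intro sum_mono divide_right_mono) (auto simp: less_imp_le)
    finally show "real (card S) \<le> (\<Sum>i\<in>S. z i / cost A c i x)" .
  qed
qed

end

theorem theorem4p3:
  fixes n :: nat and A :: "'a set" and c :: "nat \<Rightarrow> 'a \<Rightarrow> real" and x :: "'a \<Rightarrow> real"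
    and S :: "nat set"
  assumes "public_bads_instance n A c"
    and "x \<in> lotteries A"
    and "S = {i \<in> agents n. cost A c i x > 0}"
  shows "(proportionally_fair n A c x \<longleftrightarrow> lindahl_allocation n A c x) \<and>
         (lindahl_allocation n A c x \<longleftrightarrow>
            cost_vector S A c x
              \<in> critical_points S (nash S) (nonneg_vectors S) (upward_cost_set_on n A c S))"
proof -
  interpret B: public_bads n A c x
    using assms by unfold_locales
  have S: "S = B.S" using assms(3) by (simp add: B.S_def)
  show ?thesis
    unfolding S
    by (simp add: B.proportionally_fair_iff B.lindahl_allocation_iff B.critical_iff_locally_fair)
qed

end
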